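(* Let $k$ be an algebraically closed field of characteristic $p>0$ and let $\mathfrak{m}=\langle x_1,\dots,x_n\rangle\subset k[[x_1,\dots,x_n]]$. Let $0\neq f\in\mathfrak{m}$, let $w=(w_1,\dots,w_n)$ be a tuple of positive integers, and set $d=\operatorname{ord}_w(f)$ and $g=\operatorname{in}_w(f)$. Then $$\operatorname{fpt}(g)\leq\operatorname{fpt}(f)\leq\min\left\{1,\frac{w_1+\cdots+w_n}{d}\right\}.$$
   Context: For a monomial $\underline{x}^a=x_1^{a_1}\cdots x_n^{a_n}$, put $\operatorname{wt}_w(\underline{x}^a)=\sum_i w_ia_i$. For $0\neq f=\sum_a c_a\underline{x}^a\in k[[x_1,\dots,x_n]]$, $\operatorname{ord}_w(f)=\min\{\operatorname{wt}_w(\underline{x}^a):c_a\neq0\}$, and $\operatorname{in}_w(f)$ is the sum of the terms of $f$ having $w$-weight $\operatorname{ord}_w(f)$. For $e\ge 0$, $\mathfrak{m}^{[p^e]}=\langle x_1^{p^e},\dots,x_n^{p^e}\rangle$. For $h\in\mathfrak{m}$, let $\nu_e(h)$ be the largest integer $N\geq 0$ such that $h^N\notin\mathfrak{m}^{[p^e]}$; the $F$-pure threshold of $h$ is $\operatorname{fpt}(h)=\lim_{e\to\infty}\nu_e(h)/p^e$ (the limit exists). *)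

theory Defs
  imports
    Complex_Main
    "HOL-Library.Function_Algebras"
    "HOL-Library.FuncSet"
    "HOL-Computational_Algebra.Computational_Algebra"
begin

section \<open>Formal power series in finitely many variables\<close>

text \<open>
  The variables are indexed by a finite type \<open>'n\<close>; an exponent vector is a function
  \<open>'n \<Rightarrow> nat\<close>, added pointwise.
\<close>

typedef ('a, 'n) mfps = "UNIV :: (('n \<Rightarrow> nat) \<Rightarrow> 'a) set"
  morphisms mfps_coeff Abs_mfps ..

declare Abs_mfps_inverse [simplified, simp]

lemma mfps_eq_iff: "f = g \<longleftrightarrow> (\<forall>a. mfps_coeff f a = mfps_coeff g a)"
  by (simp add: mfps_coeff_inject [symmetric] fun_eq_iff)

lemma finite_exponent_pairs:
  "finite {(a, b). a + b = (c :: 'n::finite \<Rightarrow> nat)}"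
proof -
  have "finite (PiE UNIV (\<lambda>i. {..c i}))"
    by (intro finite_PiE) auto
  moreover have "{(a, b). a + b = c} \<subseteq> PiE UNIV (\<lambda>i. {..c i}) \<times> PiE UNIV (\<lambda>i. {..c i})"
    by (auto simp: PiE_def)
  ultimately show ?thesis
    by (meson finite_SigmaI finite_subset)
qed

instantiation mfps :: (comm_ring_1, finite) comm_ring_1
begin

definition zero_mfps_def: "0 = Abs_mfps (\<lambda>_. 0)"

definition one_mfps_def: "1 = Abs_mfps (\<lambda>a. if a = 0 then 1 else 0)"

definition plus_mfps_def: "f + g = Abs_mfps (\<lambda>a. mfps_coeff f a + mfps_coeff g a)"

definition minus_mfps_def: "f - g = Abs_mfps (\<lambda>a. mfps_coeff f a - mfps_coeff g a)"

definition uminus_mfps_def: "- f = Abs_mfps (\<lambda>a. - mfps_coeff f a)"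

definition times_mfps_def:
  "f * g = Abs_mfps (\<lambda>c. \<Sum>(a, b) | a + b = c. mfps_coeff f a * mfps_coeff g b)"

instance
proof
  fix f g h :: "('a, 'b) mfps"
  show "f + g + h = f + (g + h)" "f + g = g + f" "0 + f = f" "- f + f = 0" "f - g = f + - g"
    by (simp_all add: mfps_eq_iff zero_mfps_def plus_mfps_def minus_mfps_def uminus_mfps_def
        add.assoc add.commute)
  show "(0 :: ('a, 'b) mfps) \<noteq> 1"
    by (auto simp: mfps_eq_iff zero_mfps_def one_mfps_def)
  show "f * g = g * f"
    unfolding mfps_eq_iff times_mfps_def
    by (auto intro!: sum.reindex_bij_witness [where i = prod.swap and j = prod.swap]
        simp: ac_simps)
  show "(f + g) * h = f * h + g * h"
    by (simp add: mfps_eq_iff times_mfps_def plus_mfps_def distrib_right sum.distrib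
        case_prod_unfold)
  show "1 * f = f"
  proof -
    have "(\<Sum>(a, b) | a + b = c. (if a = 0 then 1 else 0) * mfps_coeff f b) = mfps_coeff f c"
      for c
    proof -
      have "(\<Sum>(a, b) | a + b = c. (if a = 0 then 1 else 0) * mfps_coeff f b) =
            (\<Sum>(a, b) \<in> {(0 :: 'b \<Rightarrow> nat, c)}. (if a = 0 then 1 else 0) * mfps_coeff f b)"
        by (rule sum.mono_neutral_right) (auto intro: finite_exponent_pairs split: if_splits)
      then show ?thesis
        by simp
    qed
    then show ?thesis
      by (simp add: mfps_eq_iff times_mfps_def one_mfps_def)
  qed
  show "f * g * h = f * (g * h)"
  proof -
    have "(\<Sum>(u, c) | u + c = s. (\<Sum>(a, b) | a + b = u. mfps_coeff f a * mfps_coeff g b) * mfps_coeff h c) =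
          (\<Sum>(a, v) | a + v = s. mfps_coeff f a * (\<Sum>(b, c) | b + c = v. mfps_coeff g b * mfps_coeff h c))"
      (is "?L = ?R") for s
    proof -
      have "?L = (\<Sum>((u, c), (a, b)) \<in> (SIGMA (u, c) : {(u, c). u + c = s}. {(a, b). a + b = u}).
                   mfps_coeff f a * mfps_coeff g b * mfps_coeff h c)"
        by (subst sum.Sigma [symmetric])
          (auto simp: finite_exponent_pairs case_prod_unfold sum_distrib_right
            finite_exponent_pairs [unfolded case_prod_unfold])
      also have "\<dots> = (\<Sum>((a, v), (b, c)) \<in> (SIGMA (a, v) : {(a, v). a + v = s}. {(b, c). b + c = v}).
                   mfps_coeff f a * (mfps_coeff g b * mfps_coeff h c))"
        by (rule sum.reindex_bij_witness
            [where i = "\<lambda>((a, v), (b, c)). ((a + b, c), (a, b))"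
               and j = "\<lambda>((u, c), (a, b)). ((a, b + c), (b, c))"])
          (auto simp: ac_simps)
      also have "\<dots> = ?R"
        by (subst sum.Sigma [symmetric])
          (auto simp: finite_exponent_pairs case_prod_unfold sum_distrib_left
            finite_exponent_pairs [unfolded case_prod_unfold])
      finally show ?thesis .
    qed
    then show ?thesis
      by (simp add: mfps_eq_iff times_mfps_def)
  qed
qed

end

definition mfps_X :: "'n::finite \<Rightarrow> ('a::comm_ring_1, 'n) mfps"
  where "mfps_X i = Abs_mfps (\<lambda>a. if a = (\<lambda>j. if j = i then 1 else 0) then 1 else 0)"


section \<open>Ideals\<close>

text \<open>An ideal is a submodule of the ring regarded as a module over itself.\<close>

definition ideal_generated :: "'a::comm_ring_1 set \<Rightarrow> 'a set"
  where "ideal_generated = module.span (*)"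

definition mfps_max_ideal :: "('a::comm_ring_1, 'n::finite) mfps set"
  where "mfps_max_ideal = ideal_generated (range mfps_X)"

definition mfps_frob_ideal :: "nat \<Rightarrow> ('a::comm_ring_1, 'n::finite) mfps set"
  where "mfps_frob_ideal e = ideal_generated (range (\<lambda>i. mfps_X i ^ (CHAR('a) ^ e)))"


section \<open>Weighted order and initial form\<close>

definition wt :: "('n::finite \<Rightarrow> nat) \<Rightarrow> ('n \<Rightarrow> nat) \<Rightarrow> nat"
  where "wt w a = (\<Sum>i\<in>UNIV. w i * a i)"

text \<open>Meaningful for \<open>f \<noteq> 0\<close> only.\<close>

definition wt_ord :: "('n::finite \<Rightarrow> nat) \<Rightarrow> ('a::comm_ring_1, 'n) mfps \<Rightarrow> nat"
  where "wt_ord w f = (LEAST d. \<exists>a. mfps_coeff f a \<noteq> 0 \<and> wt w a = d)"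

definition wt_init :: "('n::finite \<Rightarrow> nat) \<Rightarrow> ('a::comm_ring_1, 'n) mfps \<Rightarrow> ('a, 'n) mfps"
  where "wt_init w f = Abs_mfps (\<lambda>a. if wt w a = wt_ord w f then mfps_coeff f a else 0)"


section \<open>The F-pure threshold\<close>

text \<open>
  Both definitions are meant for positive characteristic and \<open>h \<in> mfps_max_ideal\<close>: then the
  exponents \<open>N\<close> below include \<open>0\<close> and are bounded, and the limit exists.
\<close>

definition fpt_nu :: "nat \<Rightarrow> ('a::comm_ring_1, 'n::finite) mfps \<Rightarrow> nat"
  where "fpt_nu e h = (GREATEST N. h ^ N \<notin> mfps_frob_ideal e)"

definition fpt :: "('a::comm_ring_1, 'n::finite) mfps \<Rightarrow> real"
  where "fpt h = lim (\<lambda>e. real (fpt_nu e h) / real (CHAR('a) ^ e))"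

end

theory Submission
  imports Defs
begin

text \<open>
  Write \<open>q = p^e\<close>. The Frobenius power of the maximal ideal is monomial: \<open>h\<close> lies outside it iff some
  monomial of \<open>h\<close> has all its exponents below \<open>q\<close>. Since the Frobenius map sends \<open>\<Sum> c\<^sub>a x\<^sup>a\<close> to
  \<open>\<Sum> c\<^sub>a\<^sup>p x\<^sup>p\<^sup>a\<close>, the sequence \<open>\<nu>\<^sub>e(h) / q\<close> is increasing and bounded by 1, so it converges.
  A monomial of \<open>f^N\<close> has weight at least \<open>N d\<close>, and at most \<open>(q - 1) \<Sum> w\<^sub>i\<close> if its exponents are
  below \<open>q\<close>, which bounds \<open>\<nu>\<^sub>e(f)\<close>. Finally \<open>g^N\<close> is the part of \<open>f^N\<close> of weight \<open>N d\<close>, so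
  every monomial of \<open>g^N\<close> occurs in \<open>f^N\<close>, whence \<open>\<nu>\<^sub>e(g) \<le> \<nu>\<^sub>e(f)\<close>.
\<close>

section \<open>Coefficients\<close>

lemma mfps_coeff_zero [simp]: "mfps_coeff 0 a = 0"
  by (simp add: zero_mfps_def)

lemma mfps_coeff_one: "mfps_coeff 1 a = (if a = 0 then 1 else 0)"
  by (simp add: one_mfps_def)

lemma mfps_coeff_add [simp]: "mfps_coeff (f + g) a = mfps_coeff f a + mfps_coeff g a"
  by (simp add: plus_mfps_def)

lemma mfps_coeff_mult:
  "mfps_coeff (f * g) c = (\<Sum>(a, b) | a + b = c. mfps_coeff f a * mfps_coeff g b)"
  by (simp add: times_mfps_def)

lemma mfps_coeff_mult_nonzeroE:
  assumes "mfps_coeff (f * g) c \<noteq> 0"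
  obtains a b where "c = a + b" "mfps_coeff f a \<noteq> 0" "mfps_coeff g b \<noteq> 0"
proof -
  from assms obtain x where "x \<in> {(a, b). a + b = c}"
    and "(case x of (a, b) \<Rightarrow> mfps_coeff f a * mfps_coeff g b) \<noteq> 0"
    unfolding mfps_coeff_mult by (rule sum.not_neutral_contains_not_neutral)
  then show thesis
    by (intro that [of "fst x" "snd x"]) auto
qed

lemma mfps_coeff_of_nat:
  "mfps_coeff (of_nat n :: ('a::comm_ring_1, 'n::finite) mfps) a = (if a = 0 then of_nat n else 0)"
  by (induction n) (auto simp: mfps_coeff_one)

text \<open>Freshman's dream refers to the characteristic of the ring that it is applied in;
  comparing constant coefficients moves it from the power series to \<open>'a\<close>.\<close>

lemma CHAR_mfps [simp]: "CHAR(('a::comm_ring_1, 'n::finite) mfps) = CHAR('a)"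
  by (rule CHAR_eqI) (auto simp: mfps_eq_iff mfps_coeff_of_nat of_nat_eq_0_iff_char_dvd dest: spec [of _ 0])

definition mfps_monom :: "'a \<Rightarrow> ('n \<Rightarrow> nat) \<Rightarrow> ('a::comm_ring_1, 'n::finite) mfps"
  where "mfps_monom c a = Abs_mfps (\<lambda>b. if b = a then c else 0)"

lemma mfps_coeff_monom: "mfps_coeff (mfps_monom c a) b = (if b = a then c else 0)"
  by (simp add: mfps_monom_def)

lemma mfps_coeff_monom_mult:
  "mfps_coeff (mfps_monom c a * f) (a + b) = c * mfps_coeff f b"
proof -
  have "mfps_coeff (mfps_monom c a * f) (a + b) =
      (\<Sum>(a', b') \<in> {(a, b)}. mfps_coeff (mfps_monom c a) a' * mfps_coeff f b')"
    unfolding mfps_coeff_mult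
    by (rule sum.mono_neutral_right)
      (auto intro: finite_exponent_pairs simp: mfps_coeff_monom split: if_splits)
  then show ?thesis
    by (simp add: mfps_coeff_monom)
qed

lemma mfps_monom_mult: "mfps_monom c a * mfps_monom c' a' = mfps_monom (c * c') (a + a')"
proof -
  have "mfps_coeff (mfps_monom c a * mfps_monom c' a') b = mfps_coeff (mfps_monom (c * c') (a + a')) b"
    for b
  proof (cases "b = a + a'")
    case True
    then show ?thesis
      by (simp add: mfps_coeff_monom_mult mfps_coeff_monom)
  next
    case False
    have "mfps_coeff (mfps_monom c a * mfps_monom c' a') b = 0"
    proof (rule ccontr)
      assume "mfps_coeff (mfps_monom c a * mfps_monom c' a') b \<noteq> 0"
      then show False
        by (rule mfps_coeff_mult_nonzeroE) (use False in \<open>auto simp: mfps_coeff_monom split: if_splits\<close>)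
    qed
    with False show ?thesis
      by (simp add: mfps_coeff_monom)
  qed
  then show ?thesis
    by (simp add: mfps_eq_iff)
qed

lemma mfps_monom_power: "mfps_monom c a ^ k = mfps_monom (c ^ k) (\<lambda>i. k * a i)"
proof (induction k)
  case 0
  show ?case
    by (auto simp: mfps_eq_iff mfps_coeff_one mfps_coeff_monom fun_eq_iff)
next
  case (Suc k)
  have "a + (\<lambda>i. k * a i) = (\<lambda>i. Suc k * a i)"
    by (auto simp: fun_eq_iff)
  with Suc show ?case
    by (simp add: mfps_monom_mult)
qed

lemma mfps_X_power:
  "(mfps_X i :: ('a::comm_ring_1, 'n::finite) mfps) ^ k = mfps_monom 1 (\<lambda>j. if j = i then k else 0)"
proof -
  have "(mfps_X i :: ('a, 'n) mfps) = mfps_monom 1 (\<lambda>j. if j = i then 1 else 0)"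
    by (simp add: mfps_X_def mfps_monom_def)
  moreover have "(\<lambda>j. k * (if j = i then 1 else 0)) = (\<lambda>j. if j = i then k else 0)"
    by auto
  ultimately show ?thesis
    by (simp add: mfps_monom_power)
qed


section \<open>Frobenius powers of the maximal ideal\<close>

interpretation ideal: module "(*) :: 'a::comm_ring_1 \<Rightarrow> 'a \<Rightarrow> 'a"
  rewrites "module.span (*) = ideal_generated"
  by unfold_locales (auto simp: algebra_simps ideal_generated_def)

lemma mfps_frob_ideal_0: "mfps_frob_ideal 0 = mfps_max_ideal"
  by (simp add: mfps_frob_ideal_def mfps_max_ideal_def)

text \<open>Induction over the span: a monomial of \<open>c * x + y\<close> occurs in
  \<open>y\<close> or in \<open>c * x\<close>, and with a generator \<open>x\<close> every monomial
  of \<open>c * x\<close> is a multiple of that generator.\<close>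

lemma mfps_frob_idealD:
  fixes h :: "('a::comm_ring_1, 'n::finite) mfps"
  assumes "h \<in> mfps_frob_ideal e" and "mfps_coeff h a \<noteq> 0"
  shows "\<exists>i. CHAR('a) ^ e \<le> a i"
  using assms unfolding mfps_frob_ideal_def
proof (induction arbitrary: a rule: ideal.span_induct_alt)
  case base
  then show ?case by simp
next
  case (step c x y)
  show ?case
  proof (cases "mfps_coeff y a = 0")
    case True
    with step.prems have "mfps_coeff (c * x) a \<noteq> 0"
      by simp
    then obtain b b' where "a = b + b'" "mfps_coeff x b' \<noteq> 0"
      by (rule mfps_coeff_mult_nonzeroE)
    moreover from step.hyps obtain i where "x = mfps_X i ^ (CHAR('a) ^ e)"
      by blast
    ultimately have "CHAR('a) ^ e \<le> a i"
      by (auto simp: mfps_X_power mfps_coeff_monom split: if_splits)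
    then show ?thesis ..
  qed (rule step.IH)
qed

text \<open>Splitting off the multiples of one \<open>x\<^sub>i\<^sup>q\<close> at a time, over the variables in \<open>S\<close>.\<close>

lemma mfps_frob_idealI_aux:
  fixes h :: "('a::comm_ring_1, 'n::finite) mfps"
  assumes "finite S" and "\<And>a. mfps_coeff h a \<noteq> 0 \<Longrightarrow> \<exists>i\<in>S. CHAR('a) ^ e \<le> a i"
  shows "h \<in> mfps_frob_ideal e"
  using assms
proof (induction arbitrary: h)
  case empty
  then have "h = 0"
    by (auto simp: mfps_eq_iff)
  then show ?case
    by (simp add: mfps_frob_ideal_def ideal.span_zero)
next
  case (insert i S)
  define q where "q = CHAR('a) ^ e"
  define u :: "'n \<Rightarrow> nat" where "u = (\<lambda>j. if j = i then q else 0)"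
  \<comment> \<open>\<open>h1\<close> is the quotient by \<open>mfps_X i ^ q\<close> of the terms
    that it divides; the exponents of the rest \<open>h2\<close> must reach \<open>q\<close> in a
    variable of \<open>S\<close>.\<close>
  define h1 where "h1 = Abs_mfps (\<lambda>b. mfps_coeff h (u + b))"
  define h2 where "h2 = Abs_mfps (\<lambda>a. if q \<le> a i then 0 else mfps_coeff h a)"
  have "mfps_coeff (mfps_monom 1 u * h1) a = (if q \<le> a i then mfps_coeff h a else 0)" for a
  proof (cases "q \<le> a i")
    case True
    \<comment> \<open>Truncated subtraction is exact here, since \<open>u\<close> is at most
      \<open>a\<close> in each coordinate.\<close>
    then have "a = u + (\<lambda>j. a j - u j)"
      by (auto simp: u_def fun_eq_iff)
    then show ?thesis
      using True mfps_coeff_monom_mult [of 1 u h1 "\<lambda>j. a j - u j"] by (simp add: h1_def)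
  next
    case False
    have "mfps_coeff (mfps_monom 1 u * h1) a = 0"
    proof (rule ccontr)
      assume "mfps_coeff (mfps_monom 1 u * h1) a \<noteq> 0"
      then obtain b b' where "a = b + b'" "mfps_coeff (mfps_monom 1 u :: ('a, 'n) mfps) b \<noteq> 0"
        by (rule mfps_coeff_mult_nonzeroE)
      with False show False
        by (auto simp: mfps_coeff_monom u_def split: if_splits)
    qed
    with False show ?thesis
      by simp
  qed
  then have h: "h = h1 * mfps_X i ^ q + h2"
    by (auto simp: mfps_eq_iff h2_def mfps_X_power mult.commute simp flip: u_def)
  have "h1 * mfps_X i ^ q \<in> mfps_frob_ideal e"
    unfolding mfps_frob_ideal_def q_def by (intro ideal.span_scale ideal.span_base) auto
  moreover have "h2 \<in> mfps_frob_ideal e"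
  proof (rule insert.IH)
    fix a assume "mfps_coeff h2 a \<noteq> 0"
    then have "mfps_coeff h a \<noteq> 0" "\<not> q \<le> a i"
      by (auto simp: h2_def split: if_splits)
    with insert.prems [of a] show "\<exists>i\<in>S. CHAR('a) ^ e \<le> a i"
      by (auto simp: q_def)
  qed
  ultimately show ?case
    unfolding h mfps_frob_ideal_def by (rule ideal.span_add)
qed

lemma not_in_mfps_frob_ideal_iff:
  fixes h :: "('a::comm_ring_1, 'n::finite) mfps"
  shows "h \<notin> mfps_frob_ideal e \<longleftrightarrow> (\<exists>a. mfps_coeff h a \<noteq> 0 \<and> (\<forall>i. a i < CHAR('a) ^ e))"
proof -
  have "h \<in> mfps_frob_ideal e \<longleftrightarrow> (\<forall>a. mfps_coeff h a \<noteq> 0 \<longrightarrow> (\<exists>i. CHAR('a) ^ e \<le> a i))"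
    using mfps_frob_idealI_aux [of UNIV h e] mfps_frob_idealD [of h e] by auto
  then show ?thesis
    by (auto simp: not_le)
qed

text \<open>The case \<open>e = 0\<close> of the criterion: the bound is then 1, and only the
  exponent vector 0 lies below it.\<close>

lemma mfps_max_ideal_iff:
  fixes h :: "('a::comm_ring_1, 'n::finite) mfps"
  shows "h \<in> mfps_max_ideal \<longleftrightarrow> mfps_coeff h 0 = 0"
proof -
  have "(\<forall>i. a i = 0) \<longleftrightarrow> a = 0" for a :: "'n \<Rightarrow> nat"
    by (simp add: fun_eq_iff)
  with not_in_mfps_frob_ideal_iff [of h 0] show ?thesis
    by (auto simp: mfps_frob_ideal_0)
qed


section \<open>The Frobenius map\<close>

lemma freshmans_dream_sum_mfps:
  fixes f :: "'b \<Rightarrow> ('a::comm_ring_1, 'n::finite) mfps"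
  assumes "prime CHAR('a)"
  shows "sum f A ^ CHAR('a) = (\<Sum>i\<in>A. f i ^ CHAR('a))"
  by (rule freshmans_dream_sum) (simp_all add: assms)

text \<open>
  The coefficient at \<open>b\<close> of a power only sees the finitely many coefficients at exponents below \<open>b\<close>,
  so \<open>h\<close> may be replaced by a finite sum of monomials plus a remainder.
\<close>

lemma mfps_coeff_power_CHAR:
  fixes h :: "('a::comm_ring_1, 'n::finite) mfps"
  assumes p: "prime CHAR('a)"
  shows "mfps_coeff (h ^ CHAR('a)) b =
    (\<Sum>a | a \<le> b. if b = (\<lambda>i. CHAR('a) * a i) then mfps_coeff h a ^ CHAR('a) else 0)"
proof -
  let ?p = "CHAR('a)"
  have fin: "finite {a. a \<le> b}"
    by (rule finite_subset [OF _ finite_PiE [of UNIV "\<lambda>i. {..b i}"]]) (auto simp: le_fun_def)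
  define h1 where "h1 = (\<Sum>a | a \<le> b. mfps_monom (mfps_coeff h a) a)"
  define h2 where "h2 = Abs_mfps (\<lambda>a. if a \<le> b then 0 else mfps_coeff h a)"
  have coeff_sum: "mfps_coeff (sum F A) c = (\<Sum>a\<in>A. mfps_coeff (F a) c)"
    for F :: "('n \<Rightarrow> nat) \<Rightarrow> ('a, 'n) mfps" and A c
    by (induction A rule: infinite_finite_induct) auto
  have "h = h1 + h2"
    using fin by (auto simp: mfps_eq_iff h1_def h2_def coeff_sum mfps_coeff_monom)
  moreover have "(h1 + h2) ^ ?p = h1 ^ ?p + h2 ^ ?p"
    by (rule freshmans_dream) (simp_all add: p)
  moreover have "\<not> a \<le> b" if "mfps_coeff (h2 ^ Suc k) a \<noteq> 0" for k a
  proof -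
    from that obtain c c' where "a = c + c'" "mfps_coeff h2 c \<noteq> 0"
      unfolding power_Suc by (rule mfps_coeff_mult_nonzeroE)
    moreover from this have "\<not> c \<le> b" "c \<le> a"
      by (auto simp: h2_def le_fun_def split: if_splits)
    ultimately show ?thesis
      using order_trans by blast
  qed
  \<comment> \<open>A positive power of \<open>h2\<close> is required, as \<open>h2 ^ 0 = 1\<close>
    has a constant term; \<open>?p > 0\<close> provides the predecessor.\<close>
  from this [of "?p - 1" b] have "mfps_coeff (h2 ^ ?p) b = 0"
    using prime_gt_0_nat [OF p] by auto
  moreover have "mfps_coeff (h1 ^ ?p) b =
      (\<Sum>a | a \<le> b. if b = (\<lambda>i. ?p * a i) then mfps_coeff h a ^ ?p else 0)"
    using freshmans_dream_sum_mfps [OF p, of "\<lambda>a. mfps_monom (mfps_coeff h a) a" "{a. a \<le> b}"]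
    by (simp add: h1_def mfps_monom_power coeff_sum mfps_coeff_monom)
  ultimately show ?thesis
    by simp
qed

text \<open>Scaling exponent vectors by the positive characteristic is injective, so just one
  summand of the general formula survives.\<close>

lemma mfps_coeff_power_CHAR_mult:
  fixes h :: "('a::comm_ring_1, 'n::finite) mfps"
  assumes p: "prime CHAR('a)"
  shows "mfps_coeff (h ^ CHAR('a)) (\<lambda>i. CHAR('a) * a i) = mfps_coeff h a ^ CHAR('a)"
proof -
  let ?p = "CHAR('a)"
  have "?p > 0"
    using p by (rule prime_gt_0_nat)
  then have eq: "(\<lambda>i. ?p * a i) = (\<lambda>i. ?p * a' i) \<longleftrightarrow> a' = a" for a' :: "'n \<Rightarrow> nat"
    by (auto simp: fun_eq_iff)
  have "finite {a'. a' \<le> (\<lambda>i. ?p * a i)}"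
    by (rule finite_subset [OF _ finite_PiE [of UNIV "\<lambda>i. {..?p * a i}"]]) (auto simp: le_fun_def)
  moreover have "a \<le> (\<lambda>i. ?p * a i)"
    using \<open>?p > 0\<close> by (auto simp: le_fun_def)
  ultimately show ?thesis
    unfolding mfps_coeff_power_CHAR [OF p] eq by simp
qed

lemma mfps_coeff_power_CHAR_power_nonzeroE:
  fixes h :: "('a::comm_ring_1, 'n::finite) mfps"
  assumes p: "prime CHAR('a)" and "mfps_coeff (h ^ (CHAR('a) ^ e)) b \<noteq> 0"
  shows "\<exists>a. b = (\<lambda>i. CHAR('a) ^ e * a i) \<and> mfps_coeff h a \<noteq> 0"
  using assms(2)
proof (induction e arbitrary: b)
  case (Suc e)
  let ?p = "CHAR('a)"
  have "mfps_coeff ((h ^ (?p ^ e)) ^ ?p) b \<noteq> 0"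
    using Suc.prems unfolding power_Suc2 power_mult .
  then obtain a where "b = (\<lambda>i. ?p * a i)" "mfps_coeff (h ^ (?p ^ e)) a ^ ?p \<noteq> 0"
    unfolding mfps_coeff_power_CHAR [OF p]
    by (elim sum.not_neutral_contains_not_neutral) (auto split: if_splits)
  moreover from this have "mfps_coeff (h ^ (?p ^ e)) a \<noteq> 0"
    using prime_gt_0_nat [OF p] by (auto simp: power_0_left)
  moreover from Suc.IH [OF this] obtain a'
    where "a = (\<lambda>i. ?p ^ e * a' i)" "mfps_coeff h a' \<noteq> 0"
    by blast
  ultimately show ?case
    by (auto simp: mult.assoc)
qed auto


section \<open>Convergence to the F-pure threshold\<close>

context
  fixes h :: "('a::idom, 'n::finite) mfps"
  assumes char: "CHAR('a) > 0" and h: "h \<in> mfps_max_ideal"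
begin

lemma prime_CHAR: "prime CHAR('a)"
  using char by (rule prime_CHAR_semidom)

text \<open>With q = p^e, each monomial of h^q is q times an exponent vector of \<open>h\<close>,
  which is nonzero because \<open>h\<close> has no constant term. So h^q and all higher powers lie
  in the ideal, and the \<open>GREATEST\<close> in \<open>fpt_nu\<close> ranges over a bounded
  set.\<close>

lemma power_not_in_mfps_frob_ideal_less:
  assumes "h ^ N \<notin> mfps_frob_ideal e"
  shows "N < CHAR('a) ^ e"
proof (rule ccontr)
  let ?q = "CHAR('a) ^ e"
  assume "\<not> N < ?q"
  then have "h ^ N = h ^ (N - ?q) * h ^ ?q"
    by (simp flip: power_add)
  moreover have "h ^ ?q \<in> mfps_frob_ideal e"
  proof (rule ccontr)
    assume "h ^ ?q \<notin> mfps_frob_ideal e"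
    then obtain b where b: "mfps_coeff (h ^ ?q) b \<noteq> 0" "\<And>i. b i < ?q"
      by (auto simp: not_in_mfps_frob_ideal_iff)
    from mfps_coeff_power_CHAR_power_nonzeroE [OF prime_CHAR b(1)]
    obtain a where a: "b = (\<lambda>i. ?q * a i)" "mfps_coeff h a \<noteq> 0"
      by blast
    with b(2) have "a = 0"
      by (auto simp: fun_eq_iff)
    with a h show False
      by (simp add: mfps_max_ideal_iff)
  qed
  ultimately have "h ^ N \<in> mfps_frob_ideal e"
    unfolding mfps_frob_ideal_def by (simp add: ideal.span_scale)
  with assms show False ..
qed

lemma power_fpt_nu_not_in: "h ^ fpt_nu e h \<notin> mfps_frob_ideal e"
proof -
  \<comment> \<open>The exponent 0 is always admissible, so the maximum is over a nonempty
    set.\<close>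
  have "h ^ 0 \<notin> mfps_frob_ideal e"
    using char by (auto simp: not_in_mfps_frob_ideal_iff mfps_coeff_one intro!: exI [of _ 0])
  then show ?thesis
    unfolding fpt_nu_def using power_not_in_mfps_frob_ideal_less less_imp_le
    by (intro GreatestI_nat [where P = "\<lambda>N. h ^ N \<notin> mfps_frob_ideal e"]) blast+
qed

lemma fpt_nu_ge: "h ^ N \<notin> mfps_frob_ideal e \<Longrightarrow> N \<le> fpt_nu e h"
  unfolding fpt_nu_def using power_not_in_mfps_frob_ideal_less less_imp_le
  by (intro Greatest_le_nat [where P = "\<lambda>N. h ^ N \<notin> mfps_frob_ideal e"]) blast+

lemma fpt_nu_Suc: "CHAR('a) * fpt_nu e h \<le> fpt_nu (Suc e) h"
proof (rule fpt_nu_ge)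
  let ?p = "CHAR('a)"
  from power_fpt_nu_not_in obtain a
    where a: "mfps_coeff (h ^ fpt_nu e h) a \<noteq> 0" "\<And>i. a i < ?p ^ e"
    by (auto simp: not_in_mfps_frob_ideal_iff)
  \<comment> \<open>The coefficient is the power of a nonzero element of a domain.\<close>
  have "mfps_coeff ((h ^ fpt_nu e h) ^ ?p) (\<lambda>i. ?p * a i) \<noteq> 0"
    using a(1) by (simp add: mfps_coeff_power_CHAR_mult [OF prime_CHAR])
  moreover have "?p * a i < ?p ^ Suc e" for i
    using a(2) [of i] char by simp
  ultimately show "h ^ (?p * fpt_nu e h) \<notin> mfps_frob_ideal (Suc e)"
    unfolding not_in_mfps_frob_ideal_iff by (metis mult.commute power_mult)
qed

lemma fpt_nu_ratio_le_1: "real (fpt_nu e h) / real (CHAR('a) ^ e) \<le> 1"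
  using power_not_in_mfps_frob_ideal_less [OF power_fpt_nu_not_in, of e] char
  by (simp add: divide_le_eq flip: of_nat_power)

text \<open>\<open>lim\<close> carries information only for a convergent sequence; this one is
  increasing by \<open>fpt_nu_Suc\<close> and bounded by 1.\<close>

lemma fpt_LIMSEQ: "(\<lambda>e. real (fpt_nu e h) / real (CHAR('a) ^ e)) \<longlonglongrightarrow> fpt h"
proof -
  have "incseq (\<lambda>e. real (fpt_nu e h) / real (CHAR('a) ^ e))"
  proof (rule incseq_SucI)
    fix e
    have "real (fpt_nu e h) / real (CHAR('a) ^ e) = real (CHAR('a) * fpt_nu e h) / real (CHAR('a) ^ Suc e)"
      using char by simp
    also have "\<dots> \<le> real (fpt_nu (Suc e) h) / real (CHAR('a) ^ Suc e)"
      by (intro divide_right_mono of_nat_mono fpt_nu_Suc of_nat_0_le_iff)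
    finally show "real (fpt_nu e h) / real (CHAR('a) ^ e) \<le>
        real (fpt_nu (Suc e) h) / real (CHAR('a) ^ Suc e)" .
  qed
  moreover have "\<forall>e. real (fpt_nu e h) / real (CHAR('a) ^ e) \<le> 1"
    by (intro allI fpt_nu_ratio_le_1)
  ultimately obtain L where "(\<lambda>e. real (fpt_nu e h) / real (CHAR('a) ^ e)) \<longlonglongrightarrow> L"
    by (rule incseq_convergent)
  then have "convergent (\<lambda>e. real (fpt_nu e h) / real (CHAR('a) ^ e))"
    by (rule convergentI)
  then show ?thesis
    unfolding fpt_def convergent_LIMSEQ_iff .
qed

end


section \<open>Weights\<close>

lemma wt_add: "wt w (a + b) = wt w a + wt w b"
  by (simp add: wt_def sum.distrib distrib_left)

lemma wt_ord_le: "mfps_coeff f a \<noteq> 0 \<Longrightarrow> wt_ord w f \<le> wt w a"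
  unfolding wt_ord_def by (rule Least_le) blast

lemma wt_ord_attained:
  assumes "f \<noteq> 0"
  obtains a where "mfps_coeff f a \<noteq> 0" "wt w a = wt_ord w f"
proof -
  from assms obtain a where "mfps_coeff f a \<noteq> 0"
    by (auto simp: mfps_eq_iff)
  then have "\<exists>d a. mfps_coeff f a \<noteq> 0 \<and> wt w a = d"
    by blast
  from LeastI_ex [OF this] that show thesis
    unfolding wt_ord_def by blast
qed

lemma wt_power_ge:
  assumes "mfps_coeff (f ^ N) a \<noteq> 0"
  shows "N * wt_ord w f \<le> wt w a"
  using assms
proof (induction N arbitrary: a)
  case (Suc N)
  from Suc.prems obtain b c
    where "a = b + c" "mfps_coeff f b \<noteq> 0" "mfps_coeff (f ^ N) c \<noteq> 0"
    unfolding power_Suc by (rule mfps_coeff_mult_nonzeroE)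
  then show ?case
    using Suc.IH [of c] wt_ord_le [of f b w] unfolding \<open>a = b + c\<close> wt_add by simp
qed simp

lemma mfps_coeff_wt_init:
  "mfps_coeff (wt_init w f) a = (if wt w a = wt_ord w f then mfps_coeff f a else 0)"
  by (simp add: wt_init_def)

lemma mfps_coeff_wt_init_power:
  "mfps_coeff (wt_init w f ^ N) a = (if wt w a = N * wt_ord w f then mfps_coeff (f ^ N) a else 0)"
proof (induction N arbitrary: a)
  case 0
  show ?case
    by (auto simp: mfps_coeff_one wt_def)
next
  case (Suc N)
  let ?d = "wt_ord w f"
  have "mfps_coeff (wt_init w f) b * mfps_coeff (wt_init w f ^ N) c =
      (if wt w (b + c) = Suc N * ?d then mfps_coeff f b * mfps_coeff (f ^ N) c else 0)" for b c
  proof (cases "mfps_coeff f b = 0 \<or> mfps_coeff (f ^ N) c = 0")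
    case False
    \<comment> \<open>Both weights are at least their minimal values, so their sum is
      \<open>Suc N * ?d\<close> only if both are equal to them.\<close>
    then have "?d \<le> wt w b" "N * ?d \<le> wt w c"
      by (auto intro: wt_ord_le wt_power_ge)
    then show ?thesis
      unfolding wt_add Suc.IH mfps_coeff_wt_init by auto
  qed (auto simp: Suc.IH mfps_coeff_wt_init)
  then have "mfps_coeff (wt_init w f ^ Suc N) a = (\<Sum>(b, c) | b + c = a.
      if wt w (b + c) = Suc N * ?d then mfps_coeff f b * mfps_coeff (f ^ N) c else 0)"
    by (simp add: mfps_coeff_mult)
  also have "\<dots> = (\<Sum>(b, c) | b + c = a.
      if wt w a = Suc N * ?d then mfps_coeff f b * mfps_coeff (f ^ N) c else 0)"
    by (rule sum.cong) auto
  also have "\<dots> = (if wt w a = Suc N * ?d then mfps_coeff (f ^ Suc N) a else 0)"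
    by (simp add: mfps_coeff_mult)
  finally show ?case .
qed

theorem proposition3p5:
  fixes f g :: "('k::alg_closed_field, 'n::finite) mfps"
    and w :: "'n \<Rightarrow> nat"
    and d :: nat
  assumes "CHAR('k) > 0"
    and "f \<in> mfps_max_ideal" and "f \<noteq> 0"
    and "\<And>i. w i > 0"
    and "d = wt_ord w f"
    and "g = wt_init w f"
  shows "fpt g \<le> fpt f \<and> fpt f \<le> min 1 (real (\<Sum>i\<in>UNIV. w i) / real d)"
proof -
  let ?q = "\<lambda>e. CHAR('k) ^ e"
  have q_pos: "?q e > 0" for e
    using assms(1) by simp
  have g: "g \<in> mfps_max_ideal"
    using assms(2) by (simp add: assms(6) mfps_max_ideal_iff mfps_coeff_wt_init)
  note nu_f = power_fpt_nu_not_in [OF assms(1,2)]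
  note lim_f = fpt_LIMSEQ [OF assms(1,2)]

  \<comment> \<open>Division by 0 yields 0 in HOL, so the last bound requires a positive
    \<open>d\<close>. A monomial of \<open>f\<close> of weight \<open>d\<close> involves some
    variable, whose weight is positive.\<close>
  have "d > 0"
  proof -
    obtain a where a: "mfps_coeff f a \<noteq> 0" "wt w a = d"
      using wt_ord_attained [OF assms(3)] assms(5) by metis
    with assms(2) have "a \<noteq> 0"
      by (auto simp: mfps_max_ideal_iff)
    then obtain i where "a i > 0"
      by (auto simp: fun_eq_iff)
    with assms(4) [of i] have "0 < w i * a i"
      by simp
    also have "\<dots> \<le> d"
      unfolding a(2) [symmetric] wt_def by (rule member_le_sum) auto
    finally show ?thesis .
  qed

  have "fpt_nu e g \<le> fpt_nu e f" for e
  proof -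
    from power_fpt_nu_not_in [OF assms(1) g] obtain a
      where "mfps_coeff (g ^ fpt_nu e g) a \<noteq> 0" "\<forall>i. a i < ?q e"
      by (auto simp: not_in_mfps_frob_ideal_iff)
    \<comment> \<open>The monomial found in the power of \<open>g\<close> has the same nonzero
      coefficient in that power of \<open>f\<close>.\<close>
    then have "f ^ fpt_nu e g \<notin> mfps_frob_ideal e"
      by (auto simp: assms(6) mfps_coeff_wt_init_power not_in_mfps_frob_ideal_iff split: if_splits)
    then show ?thesis
      by (rule fpt_nu_ge [OF assms(1,2)])
  qed
  then have "fpt g \<le> fpt f"
    using fpt_LIMSEQ [OF assms(1) g] lim_f by (intro LIMSEQ_le) (auto intro!: divide_right_mono)
  moreover have "fpt f \<le> 1"
    using lim_f fpt_nu_ratio_le_1 [OF assms(1,2)] by (intro LIMSEQ_le_const2) auto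
  moreover have "fpt f \<le> real (\<Sum>i\<in>UNIV. w i) / real d"
  proof (rule LIMSEQ_le_const2 [OF lim_f], intro exI allI impI)
    fix e
    from nu_f obtain a where a: "mfps_coeff (f ^ fpt_nu e f) a \<noteq> 0" "\<And>i. a i < ?q e"
      by (auto simp: not_in_mfps_frob_ideal_iff)
    have "fpt_nu e f * d \<le> wt w a"
      using wt_power_ge [OF a(1)] assms(5) by simp
    \<comment> \<open>The weak bound of each exponent by \<open>?q e\<close> suffices: division by
      \<open>d\<close> and \<open>?q e\<close> gives the claimed ratio for every \<open>e\<close>,
      hence for the limit.\<close>
    also have "\<dots> \<le> (\<Sum>i\<in>UNIV. w i) * ?q e"
      unfolding wt_def sum_distrib_right using a(2) by (intro sum_mono mult_left_mono) (auto intro: less_imp_le)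
    finally have "real (fpt_nu e f * d) \<le> real ((\<Sum>i\<in>UNIV. w i) * ?q e)"
      by (simp only: of_nat_le_iff)
    then show "real (fpt_nu e f) / real (?q e) \<le> real (\<Sum>i\<in>UNIV. w i) / real d"
      using \<open>d > 0\<close> q_pos [of e] by (simp add: divide_simps flip: of_nat_power of_nat_sum)
  qed
  ultimately show ?thesis
    by simp
qed

end
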